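(* Let $\mathbf{u}=(u_1,u_2)$ be an $\mathbb{R}^2$-valued random variable whose density function $f$ is invariant under $90^\circ$ rotation, i.e. $$f(x_1,x_2)=f(-x_2,x_1)=f(-x_1,-x_2)=f(x_2,-x_1)\qquad\text{for all }(x_1,x_2)\in\mathbb{R}^2 .$$ Let $h(\mathbf{w})=H(\langle\mathbf{w},\mathbf{u}\rangle)$ for $\mathbf{w}\in S^2$. If $h$ has a minimum on the set $\{\mathbf{w}\in S^2: w_1\ge 0,\ w_2\ge 0\}$, then $h$ attains its minimum over $S^2$ on an orthonormal basis, i.e. there is an orthonormal basis $\{\mathbf{b}_1,\mathbf{b}_2\}$ of $\mathbb{R}^2$ with $h(\mathbf{b}_1)=h(\mathbf{b}_2)=\min_{\mathbf{w}\in S^2}h(\mathbf{w})$. Consequently, some orthogonal transform of $\mathbf{u}$ satisfies the hypothesis of the ISA separation theorem: for the orthogonal matrix $\mathbf{C}$ with rows $\mathbf{b}_1^T,\mathbf{b}_2^T$ and $\mathbf{v}=\mathbf{C}\mathbf{u}$, $$H(w_1v_1+w_2v_2)\ \ge\ w_1^2H(v_1)+w_2^2H(v_2)\qquad\text{for all }\mathbf{w}=(w_1,w_2)\in S^2 .$$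
   Context: $S^2:=\{\mathbf{w}\in\mathbb{R}^2:w_1^2+w_2^2=1\}$ is the unit circle (superscript is the dimension of the ambient space), and $\langle\mathbf{w},\mathbf{u}\rangle=w_1u_1+w_2u_2$. $H$ denotes Shannon's differential entropy with natural logarithm; the entropies $H(\langle\mathbf{w},\mathbf{u}\rangle)$, $\mathbf{w}\in S^2$, are assumed to exist and be finite. In Independent Subspace Analysis (ISA), the sources (independent random vectors $\mathbf{s}^m\in\mathbb{R}^d$, here $d=2$ and $\mathbf{u}=\mathbf{s}^m$) are determined only up to orthogonal transformations within each subspace, and the hypothesis on a source in the ISA separation theorem is the inequality $H(\sum_i w_i s^m_i)\ge\sum_i w_i^2H(s^m_i)$ for all unit vectors $\mathbf{w}$; it is enough that it holds for some orthogonal transform $\mathbf{C}^m\mathbf{s}^m$ of the source. *)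

theory Defs
  imports "HOL-Probability.Probability"
begin

(* Base exp 1, i.e. natural logarithm; the reference measure is Lebesgue measure on the line. *)
definition diff_entropy :: "'a measure \<Rightarrow> ('a \<Rightarrow> real) \<Rightarrow> real" where
  "diff_entropy M X = prob_space.entropy M (exp 1) lborel X"

(* The library entropy is a Bochner integral, hence a total function with the junk value 0 when
   the integral diverges; this predicate says that the differential entropy exists and is finite. *)
definition has_diff_entropy :: "'a measure \<Rightarrow> ('a \<Rightarrow> real) \<Rightarrow> bool" where
  "has_diff_entropy M X \<longleftrightarrow> (\<exists>g. information_space.finite_entropy M (exp 1) lborel X g)"

definition orthonormal_basis :: "'a::euclidean_space set \<Rightarrow> bool" where
  "orthonormal_basis B \<longleftrightarrow>
     pairwise orthogonal B \<and> (\<forall>b\<in>B. norm b = 1) \<and> span B = UNIV"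

end

theory Submission
  imports Defs
begin

text \<open>
  A quarter turn is an orthogonal map that permutes boxes, so it preserves Lebesgue measure; as it
  also preserves the density, it preserves the law of \<open>u\<close>. Hence \<open>h\<close> is constant on the orbits of the
  quarter turn. Every such orbit on the circle meets the closed first quadrant, so a minimum \<open>b\<close> over the
  quadrant is global, and \<open>b\<close> together with its quarter turn is the required basis. The final
  inequality holds because its right-hand side is the minimum of \<open>h\<close>.
\<close>

definition quarter_turn :: "real^2 \<Rightarrow> real^2" where
  "quarter_turn x = vector [- x $ 2, x $ 1]"

lemma quarter_turn_nth [simp]:
  "quarter_turn x $ 1 = - x $ 2" "quarter_turn x $ 2 = x $ 1"
  by (simp_all add: quarter_turn_def)

lemma quarter_turn_quarter_turn [simp]: "quarter_turn (quarter_turn x) = - x"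
  by (simp add: vec_eq_iff forall_2)

text \<open>The adjoint of a rotation is its inverse, and the inverse of a quarter turn is its
  negative. This moves the turn from the direction \<open>w\<close> to the random vector.\<close>

lemma inner_quarter_turn: "quarter_turn x \<bullet> y = - (x \<bullet> quarter_turn y)"
  by (simp add: inner_vec_def sum_2)

lemma orthogonal_quarter_turn: "orthogonal x (quarter_turn x)"
  by (simp add: orthogonal_def inner_vec_def sum_2)

lemma norm_quarter_turn [simp]: "norm (quarter_turn x) = norm x"
  by (simp add: norm_vec_def L2_set_def sum_2 add.commute)

lemma continuous_on_quarter_turn: "continuous_on A quarter_turn"
proof -
  have "linear quarter_turn"
    by (rule linearI) (simp_all add: vec_eq_iff forall_2)
  then show ?thesis
    by (simp add: linear_continuous_on linear_conv_bounded_linear)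
qed

lemma measurable_quarter_turn [measurable]: "quarter_turn \<in> borel_measurable borel"
  by (rule borel_measurable_continuous_onI[OF continuous_on_quarter_turn])

lemma mem_box_vec_2:
  "x \<in> box a b \<longleftrightarrow> a $ 1 < x $ 1 \<and> x $ 1 < b $ 1 \<and> a $ 2 < x $ 2 \<and> x $ 2 < b $ 2"
  for x :: "real^2"
  by (auto simp: mem_box_cart forall_2)

lemma prod_Basis_vec_2: "(\<Prod>b\<in>Basis. x \<bullet> b) = x $ 1 * x $ 2" for x :: "real^2"
proof -
  have Basis_2: "(Basis :: (real^2) set) = {axis 1 1, axis 2 1}"
    by (auto simp: Basis_vec_def UNIV_2)
  show ?thesis
    unfolding Basis_2 by (simp add: inner_axis axis_eq_axis)
qed

text \<open>Lebesgue measure is determined by its values on boxes. The preimage of a box is a box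
  with the two side lengths interchanged, so the volume is unchanged.\<close>

lemma distr_lborel_quarter_turn: "distr lborel borel quarter_turn = lborel"
proof (rule lborel_eqI[symmetric])
  fix l r :: "real^2"
  assume le: "\<And>b. b \<in> Basis \<Longrightarrow> l \<bullet> b \<le> r \<bullet> b"
  \<comment> \<open>Solving \<open>l $ 1 < - x $ 2 < r $ 1\<close> and
    \<open>l $ 2 < x $ 1 < r $ 2\<close> for \<open>x\<close>; the negation swaps the endpoints of
    the second side.\<close>
  define l' r' :: "real^2" where "l' = vector [l $ 2, - r $ 1]" and "r' = vector [r $ 2, - l $ 1]"
  have le': "l $ i \<le> r $ i" for i
    using le[of "axis i 1"] by (simp add: inner_axis axis_in_Basis_iff)
  have vimage: "quarter_turn -` box l r = box l' r'"
    by (auto simp: mem_box_vec_2 l'_def r'_def)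
  have "\<forall>b\<in>Basis. l' \<bullet> b \<le> r' \<bullet> b"
    using le' by (auto simp: Basis_vec_def inner_axis l'_def r'_def UNIV_2)
  then have "emeasure lborel (box l' r') = (\<Prod>b\<in>Basis. (r' - l') \<bullet> b)"
    by (intro emeasure_lborel_box) auto
  also have "\<dots> = (\<Prod>b\<in>Basis. (r - l) \<bullet> b)"
    by (simp add: prod_Basis_vec_2 l'_def r'_def mult.commute)
  finally show "emeasure (distr lborel borel quarter_turn) (box l r) = (\<Prod>b\<in>Basis. (r - l) \<bullet> b)"
    by (simp add: emeasure_distr vimage)
qed simp

text \<open>Change of variables: a density over a pushed-forward measure is the pushforward of the
  pulled-back density, and here both the base measure and \<open>g\<close> are invariant.\<close>

lemma distr_density_quarter_turn:
  assumes [measurable]: "g \<in> borel_measurable borel"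
    and inv: "\<And>x. g (quarter_turn x) = g x"
  shows "distr (density lborel g) borel quarter_turn = density lborel g"
proof -
  have "density lborel g = density (distr lborel borel quarter_turn) g"
    by (simp add: distr_lborel_quarter_turn)
  also have "\<dots> = distr (density lborel (\<lambda>x. g (quarter_turn x))) borel quarter_turn"
    by (rule density_distr) simp_all
  also have "\<dots> = distr (density lborel g) borel quarter_turn"
    by (simp only: inv)
  finally show ?thesis ..
qed

text \<open>Once unfolded, the entropy refers to the random variable only through its law.\<close>

lemma diff_entropy_distr_cong:
  assumes "prob_space M" and "distr M lborel X = distr M lborel Y"
  shows "diff_entropy M X = diff_entropy M Y"
proof -
  interpret information_space M "exp 1"
    using assms(1) by (simp add: information_space_def information_space_axioms_def)
  show ?thesis
    by (simp add: diff_entropy_def entropy_def assms(2))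
qed

lemma diff_entropy_inner_quarter_turn:
  fixes u :: "'a \<Rightarrow> real^2"
  assumes prob: "prob_space M"
    and density: "distributed M lborel u g"
    and inv: "\<And>x. g (quarter_turn x) = g x"
  shows "diff_entropy M (\<lambda>\<omega>. quarter_turn w \<bullet> u \<omega>) = diff_entropy M (\<lambda>\<omega>. w \<bullet> u \<omega>)"
proof (rule diff_entropy_distr_cong[OF prob])
  let ?P = "density lborel g"
  have [measurable]: "g \<in> borel_measurable borel" "u \<in> borel_measurable M"
    using density by (auto simp: distributed_def)
  have law: "distr M borel u = ?P"
    using distributed_distr_eq_density[OF density] by (simp cong: distr_cong)
  have push: "distr M lborel (\<lambda>\<omega>. k (u \<omega>)) = distr ?P borel k"
    if [measurable]: "k \<in> borel_measurable borel" for k :: "real^2 \<Rightarrow> real"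
    by (simp add: law[symmetric] distr_distr comp_def cong: distr_cong)
  have twice: "distr ?P borel (\<lambda>x. k (quarter_turn x)) = distr ?P borel k"
    if [measurable]: "k \<in> borel_measurable borel" for k :: "real^2 \<Rightarrow> real"
  proof -
    have "distr ?P borel (\<lambda>x. k (quarter_turn x)) = distr (distr ?P borel quarter_turn) borel k"
      by (simp add: distr_distr comp_def)
    then show ?thesis
      by (simp add: distr_density_quarter_turn inv)
  qed
  \<comment> \<open>Turning the integration variable leaves the law unchanged; the two turns then
    cancel in the inner product, the two minus signs included.\<close>
  have "distr ?P borel (\<lambda>x. quarter_turn w \<bullet> x)
      = distr ?P borel (\<lambda>x. quarter_turn w \<bullet> quarter_turn x)"
    by (rule twice[symmetric]) simp
  also have "\<dots> = distr ?P borel (\<lambda>x. w \<bullet> x)"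
    by (simp add: inner_quarter_turn)
  finally show "distr M lborel (\<lambda>\<omega>. quarter_turn w \<bullet> u \<omega>) = distr M lborel (\<lambda>\<omega>. w \<bullet> u \<omega>)"
    by (simp add: push)
qed

text \<open>The turn has order four and permutes the closed quadrants cyclically, so at most three
  turns bring \<open>w\<close> into the first one.\<close>

lemma quarter_turn_orbit_meets_quadrant:
  obtains n where "0 \<le> (quarter_turn ^^ n) w $ 1" "0 \<le> (quarter_turn ^^ n) w $ 2"
proof -
  have "\<exists>n\<in>{0, 1, 2, 3}. 0 \<le> (quarter_turn ^^ n) w $ 1 \<and> 0 \<le> (quarter_turn ^^ n) w $ 2"
    by (simp add: eval_nat_numeral) linarith
  then show ?thesis
    using that by blast
qed

lemma is_arg_min_sphere_of_quadrant:
  fixes h :: "real^2 \<Rightarrow> real"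
  assumes inv: "\<And>w. h (quarter_turn w) = h w"
    and min: "is_arg_min h (\<lambda>w. w \<in> sphere 0 1 \<and> 0 \<le> w $ 1 \<and> 0 \<le> w $ 2) b"
  shows "is_arg_min h (\<lambda>w. w \<in> sphere 0 1) b"
  unfolding is_arg_min_linorder
proof (intro conjI allI impI)
  show "b \<in> sphere 0 1"
    using min by (simp add: is_arg_min_linorder)
  fix w :: "real^2"
  assume w: "w \<in> sphere 0 1"
  obtain n where n: "0 \<le> (quarter_turn ^^ n) w $ 1" "0 \<le> (quarter_turn ^^ n) w $ 2"
    by (rule quarter_turn_orbit_meets_quadrant)
  have "norm ((quarter_turn ^^ n) w) = norm w"
    by (induction n) simp_all
  with w n have "h b \<le> h ((quarter_turn ^^ n) w)"
    using min by (simp add: is_arg_min_linorder)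
  also have "\<dots> = h w"
    by (induction n) (simp_all add: inv)
  finally show "h b \<le> h w" .
qed

lemma orthonormal_basis_quarter_turn:
  assumes "norm b = 1"
  shows "orthonormal_basis {b, quarter_turn b}"
proof -
  have orth: "pairwise orthogonal {b, quarter_turn b}"
    using orthogonal_quarter_turn[of b] by (auto simp: pairwise_def orthogonal_commute)
  have nz: "b \<noteq> 0" "quarter_turn b \<noteq> 0"
    using assms norm_quarter_turn[of b] by (metis norm_zero zero_neq_one)+
  then have ind: "independent {b, quarter_turn b}"
    using orth by (intro pairwise_orthogonal_independent) auto
  \<comment> \<open>Distinctness makes the cardinality 2, so that independence forces the span to be
    the whole plane.\<close>
  have "b \<noteq> quarter_turn b"
    using orthogonal_quarter_turn[of b] nz(1) by (metis orthogonal_self)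
  then have "card {b, quarter_turn b} = DIM(real^2)"
    by simp
  then have "span {b, quarter_turn b} = UNIV"
    using card_eq_dim[of "{b, quarter_turn b}" UNIV] ind by auto
  with orth assms show ?thesis
    by (simp add: orthonormal_basis_def)
qed

theorem theorem2:
  fixes M :: "'a measure"
    and u :: "'a \<Rightarrow> real^2"
    and f :: "real^2 \<Rightarrow> real"
    and h :: "real^2 \<Rightarrow> real"
  defines "h \<equiv> \<lambda>w. diff_entropy M (\<lambda>\<omega>. w \<bullet> u \<omega>)"
  assumes prob: "prob_space M"
    and f_nonneg: "\<forall>x. 0 \<le> f x"
    and density: "distributed M lborel u (\<lambda>x. ennreal (f x))"
    and rotation: "\<forall>x1 x2.
          f (vector [x1, x2]) = f (vector [- x2, x1]) \<and>
          f (vector [- x2, x1]) = f (vector [- x1, - x2]) \<and>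
          f (vector [- x1, - x2]) = f (vector [x2, - x1])"
    and entropies: "\<forall>w\<in>sphere 0 1. has_diff_entropy M (\<lambda>\<omega>. w \<bullet> u \<omega>)"
    and quadrant_min: "\<exists>w0. is_arg_min h (\<lambda>w. w \<in> sphere 0 1 \<and> 0 \<le> w $ 1 \<and> 0 \<le> w $ 2) w0"
  shows "\<exists>b1 b2.
           orthonormal_basis {b1, b2} \<and>
           is_arg_min h (\<lambda>w. w \<in> sphere 0 1) b1 \<and>
           is_arg_min h (\<lambda>w. w \<in> sphere 0 1) b2 \<and>
           h b1 = h b2 \<and>
           (\<exists>C :: real^2^2. orthogonal_matrix C \<and> row 1 C = b1 \<and> row 2 C = b2 \<and>
              (let v = (\<lambda>\<omega>. C *v u \<omega>) in
                 \<forall>w :: real^2. w \<in> sphere 0 1 \<longrightarrow>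
                   diff_entropy M (\<lambda>\<omega>. w $ 1 * v \<omega> $ 1 + w $ 2 * v \<omega> $ 2)
                     \<ge> (w $ 1)\<^sup>2 * diff_entropy M (\<lambda>\<omega>. v \<omega> $ 1)
                       + (w $ 2)\<^sup>2 * diff_entropy M (\<lambda>\<omega>. v \<omega> $ 2)))"
proof -
  have inv: "ennreal (f (quarter_turn x)) = ennreal (f x)" for x
  proof -
    \<comment> \<open>In this form the first equality in \<open>rotation\<close> is exactly
      invariance under \<open>quarter_turn\<close>.\<close>
    have "x = vector [x $ 1, x $ 2]"
      by (simp add: vec_eq_iff forall_2)
    then show ?thesis
      using rotation unfolding quarter_turn_def by metis
  qed
  have h_inv: "h (quarter_turn w) = h w" for w
    unfolding h_def by (rule diff_entropy_inner_quarter_turn[OF prob density inv])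
  obtain b where "is_arg_min h (\<lambda>w. w \<in> sphere 0 1 \<and> 0 \<le> w $ 1 \<and> 0 \<le> w $ 2) b"
    using quadrant_min by blast
  then have b_min: "is_arg_min h (\<lambda>w. w \<in> sphere 0 1) b"
    by (rule is_arg_min_sphere_of_quadrant[of h, OF h_inv])
  then have b_norm: "norm b = 1" and h_ge: "\<And>w. norm w = 1 \<Longrightarrow> h b \<le> h w"
    by (simp_all add: is_arg_min_linorder)
  define c where "c = quarter_turn b"
  have c_min: "is_arg_min h (\<lambda>w. w \<in> sphere 0 1) c"
    using b_min by (simp add: is_arg_min_linorder c_def h_inv)
  define C :: "real^2^2" where "C = vector [b, c]"
  have rows: "row 1 C = b" "row 2 C = c"
    by (simp_all add: C_def row_def vec_eq_iff)
  have "orthogonal_matrix C"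
    unfolding orthogonal_matrix_orthonormal_rows forall_2
    using b_norm orthogonal_quarter_turn[of b] by (simp add: rows c_def orthogonal_commute)
  moreover have "diff_entropy M (\<lambda>\<omega>. w $ 1 * (C *v u \<omega>) $ 1 + w $ 2 * (C *v u \<omega>) $ 2)
      \<ge> (w $ 1)\<^sup>2 * diff_entropy M (\<lambda>\<omega>. (C *v u \<omega>) $ 1)
        + (w $ 2)\<^sup>2 * diff_entropy M (\<lambda>\<omega>. (C *v u \<omega>) $ 2)"
    if w: "w \<in> sphere 0 1" for w :: "real^2"
  proof -
    have ww: "(w $ 1)\<^sup>2 + (w $ 2)\<^sup>2 = 1"
      using w by (simp add: norm_eq_1 inner_vec_def sum_2 power2_eq_square)
    have Cu: "(C *v x) $ 1 = b \<bullet> x" "(C *v x) $ 2 = c \<bullet> x" for x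
      by (simp_all add: matrix_vector_mul_component C_def)
    \<comment> \<open>The combination \<open>w $ 1 * v \<omega> $ 1 + w $ 2 * v \<omega> $ 2\<close>
      is the projection of \<open>u \<omega>\<close> onto this vector, so its entropy is a value of
      \<open>h\<close> on the circle once the vector is shown to be unit.\<close>
    have "(norm (w $ 1 *\<^sub>R b + w $ 2 *\<^sub>R c))\<^sup>2 = (norm (w $ 1 *\<^sub>R b))\<^sup>2 + (norm (w $ 2 *\<^sub>R c))\<^sup>2"
      using orthogonal_quarter_turn[of b]
      by (intro norm_add_Pythagorean) (simp add: c_def orthogonal_clauses)
    also have "\<dots> = 1"
      using ww b_norm by (simp add: c_def)
    finally have "norm (w $ 1 *\<^sub>R b + w $ 2 *\<^sub>R c) = 1"
      by (simp add: power2_eq_1_iff) (metis norm_ge_zero not_one_le_zero neg_0_le_iff_le)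
    then have "h b \<le> h (w $ 1 *\<^sub>R b + w $ 2 *\<^sub>R c)"
      by (rule h_ge)
    \<comment> \<open>The weights sum to 1 and \<open>h c = h b\<close>, so the weighted average
      collapses to the minimum.\<close>
    moreover have "(w $ 1)\<^sup>2 * h b + (w $ 2)\<^sup>2 * h c = h b"
      using ww by (simp add: c_def h_inv flip: distrib_right)
    ultimately show ?thesis
      by (simp add: Cu h_def inner_add_left)
  qed
  ultimately show ?thesis
    using orthonormal_basis_quarter_turn[OF b_norm] b_min c_min rows
    by (intro exI[of _ b] exI[of _ c] conjI exI[of _ C]) (simp_all add: c_def h_inv Let_def)
qed

end
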